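(* Let $(G,\mathsf{ConjEvenParity}(\alpha_1,\dots,\alpha_k))$ be a generalized parity game with priority functions $\alpha_\ell:V\to[d_\ell]$, and let $F^{(0)}=\mathsf{GoodEp}_0(G,\alpha_1,\dots,\alpha_k)$ be the set defined in the context. For all $v_0\in V$, if $v_0\in\mathsf{Attr}_0(G,F^{(0)})$, then $v_0\in\mathsf{Win}(G,0,\mathsf{ConjEvenParity}(\alpha_1,\dots,\alpha_k))$.
   Context: A game structure $G=(V_0,V_1,E)$ consists of a finite directed graph $(V,E)$ with $V=V_0\sqcup V_1$ ($V_i$ controlled by player $i$) in which every vertex has an outgoing edge. Plays are infinite paths; $\mathsf{Inf}(\pi)$ is the set of vertices occurring infinitely often in $\pi$. A strategy of player $i$ maps each history (finite path) ending in $V_i$ to a successor of its last vertex. For a set of plays $\Omega$, $\mathsf{Win}(G,i,\Omega)$ is the set of vertices $v_0$ from which player $i$ has a strategy such that all plays from $v_0$ consistent with it belong to $\Omega$. With $[d]=\{0,\dots,d\}$ and $k\ge1$, $\mathsf{ConjEvenParity}(\alpha_1,\dots,\alpha_k)$ is the set of plays $\pi$ such that $\max_{v\in\mathsf{Inf}(\pi)}\alpha_\ell(v)$ is even for all $\ell\in\{1,\dots,k\}$. A $0$-priority is an even number. Controllable predecessors: $\mathsf{Cpre}_0(G,U)=\{v\in V_0\mid\exists(v,v')\in E,\ v'\in U\}\cup\{v\in V_1\mid\forall(v,v')\in E,\ v'\in U\}$. Attractor: $\mathsf{Attr}_0(G,U)=\bigcup_{j\ge0}X_j$ with $X_0=U$,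 $X_{j+1}=X_j\cup\mathsf{Cpre}_0(G,X_j)$. Positive attractor: $\mathsf{PAttr}_0(G,U)=\bigcup_{j\ge0}X_j$ with $X_0=\mathsf{Cpre}_0(G,U)$, $X_{j+1}=X_j\cup\mathsf{Cpre}_0(G,X_j\cup U)$. Extended structure: with $M_\ell=[d_\ell]$, $G\times M_1\times\dots\times M_k$ has vertex set $V\times M_1\times\dots\times M_k$, player $i$ controls $V_i\times M_1\times\dots\times M_k$, and edges are the pairs $((v,m_1,\dots,m_k),(v',m'_1,\dots,m'_k))$ with $(v,v')\in E$ and $m'_\ell=\max\{m_\ell,\alpha_\ell(v)\}$ for all $\ell$. The set $\mathsf{GoodEp}_0(G,\alpha_1,\dots,\alpha_k)$ is $\bigcap_{j\ge0}F_j$, where $F_0=V$ and, for $j\ge1$: $T_j=\{(v,m_1,\dots,m_k)\mid v\in F_{j-1}\text{ and every }m_\ell\in M_\ell\text{ is a }0\text{-priority}\}$, $A_j=\mathsf{PAttr}_0(G\times M_1\times\dots\times M_k,T_j)$, $F_j=\{v\in V\mid(v,\alpha_1(v),\dots,\alpha_k(v))\in A_j\}\cap F_{j-1}$. *)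

theory Defs
  imports "HOL-Library.Infinite_Set" "HOL-Library.FuncSet"
begin

datatype player = Player0 | Player1

record 'v game =
  ctrl :: "player \<Rightarrow> 'v set"
  edges :: "('v \<times> 'v) set"

definition verts :: "'v game \<Rightarrow> 'v set" where
  "verts G = ctrl G Player0 \<union> ctrl G Player1"

definition game_structure :: "'v game \<Rightarrow> bool" where
  "game_structure G \<longleftrightarrow>
     finite (verts G) \<and>
     ctrl G Player0 \<inter> ctrl G Player1 = {} \<and>
     edges G \<subseteq> verts G \<times> verts G \<and>
     (\<forall>v\<in>verts G. \<exists>v'. (v, v') \<in> edges G)"

definition play :: "'v game \<Rightarrow> (nat \<Rightarrow> 'v) \<Rightarrow> bool" where
  "play G \<pi> \<longleftrightarrow> (\<forall>n. (\<pi> n, \<pi> (Suc n)) \<in> edges G)"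

definition inf_vertices :: "(nat \<Rightarrow> 'v) \<Rightarrow> 'v set" where
  "inf_vertices \<pi> = {v. \<exists>\<^sub>\<infinity>n. \<pi> n = v}"

definition history :: "'v game \<Rightarrow> 'v list \<Rightarrow> bool" where
  "history G h \<longleftrightarrow>
     h \<noteq> [] \<and> set h \<subseteq> verts G \<and> successively (\<lambda>u v. (u, v) \<in> edges G) h"

text \<open>Strategies are total functions on lists; only their values on histories ending in a
  vertex of the player are relevant.\<close>

definition strategy :: "'v game \<Rightarrow> player \<Rightarrow> ('v list \<Rightarrow> 'v) \<Rightarrow> bool" where
  "strategy G i \<sigma> \<longleftrightarrow>
     (\<forall>h. history G h \<and> last h \<in> ctrl G i \<longrightarrow> (last h, \<sigma> h) \<in> edges G)"

definition consistent :: "'v game \<Rightarrow> player \<Rightarrow> ('v list \<Rightarrow> 'v) \<Rightarrow> (nat \<Rightarrow> 'v) \<Rightarrow> bool" where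
  "consistent G i \<sigma> \<pi> \<longleftrightarrow>
     (\<forall>n. \<pi> n \<in> ctrl G i \<longrightarrow> \<pi> (Suc n) = \<sigma> (map \<pi> [0..<Suc n]))"

definition Win :: "'v game \<Rightarrow> player \<Rightarrow> (nat \<Rightarrow> 'v) set \<Rightarrow> 'v set" where
  "Win G i \<Omega> =
     {v0 \<in> verts G. \<exists>\<sigma>. strategy G i \<sigma> \<and>
        (\<forall>\<pi>. play G \<pi> \<and> \<pi> 0 = v0 \<and> consistent G i \<sigma> \<pi> \<longrightarrow> \<pi> \<in> \<Omega>)}"

text \<open>Priority functions are indexed by \<open>{1..k}\<close>. On a play of a game structure the maximum
  is taken over a finite nonempty set.\<close>

definition ConjEvenParity :: "'v game \<Rightarrow> nat \<Rightarrow> (nat \<Rightarrow> 'v \<Rightarrow> nat) \<Rightarrow> (nat \<Rightarrow> 'v) set" where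
  "ConjEvenParity G k \<alpha> =
     {\<pi>. play G \<pi> \<and> (\<forall>l\<in>{1..k}. even (Max (\<alpha> l ` inf_vertices \<pi>)))}"

definition Cpre0 :: "'v game \<Rightarrow> 'v set \<Rightarrow> 'v set" where
  "Cpre0 G U =
     {v \<in> ctrl G Player0. \<exists>v'. (v, v') \<in> edges G \<and> v' \<in> U} \<union>
     {v \<in> ctrl G Player1. \<forall>v'. (v, v') \<in> edges G \<longrightarrow> v' \<in> U}"

primrec Attr0_iter :: "'v game \<Rightarrow> 'v set \<Rightarrow> nat \<Rightarrow> 'v set" where
  "Attr0_iter G U 0 = U"
| "Attr0_iter G U (Suc j) = Attr0_iter G U j \<union> Cpre0 G (Attr0_iter G U j)"

definition Attr0 :: "'v game \<Rightarrow> 'v set \<Rightarrow> 'v set" where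
  "Attr0 G U = (\<Union>j. Attr0_iter G U j)"

primrec PAttr0_iter :: "'v game \<Rightarrow> 'v set \<Rightarrow> nat \<Rightarrow> 'v set" where
  "PAttr0_iter G U 0 = Cpre0 G U"
| "PAttr0_iter G U (Suc j) = PAttr0_iter G U j \<union> Cpre0 G (PAttr0_iter G U j \<union> U)"

definition PAttr0 :: "'v game \<Rightarrow> 'v set \<Rightarrow> 'v set" where
  "PAttr0 G U = (\<Union>j. PAttr0_iter G U j)"

text \<open>Tuples \<open>(m\<^sub>1, \<dots>, m\<^sub>k)\<close> in \<open>M\<^sub>1 \<times> \<dots> \<times> M\<^sub>k\<close> are functions on \<open>{1..k}\<close> that are
  \<open>undefined\<close> outside this set, so that equality of tuples is equality of functions.\<close>

definition memories :: "nat \<Rightarrow> (nat \<Rightarrow> nat) \<Rightarrow> (nat \<Rightarrow> nat) set" where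
  "memories k d = (\<Pi>\<^sub>E l\<in>{1..k}. {0..d l})"

definition extended_game ::
  "'v game \<Rightarrow> nat \<Rightarrow> (nat \<Rightarrow> nat) \<Rightarrow> (nat \<Rightarrow> 'v \<Rightarrow> nat) \<Rightarrow> ('v \<times> (nat \<Rightarrow> nat)) game" where
  "extended_game G k d \<alpha> =
     \<lparr>ctrl = (\<lambda>i. ctrl G i \<times> memories k d),
      edges = {((v, m), (v', m')). (v, v') \<in> edges G \<and>
                 m \<in> memories k d \<and> m' \<in> memories k d \<and>
                 (\<forall>l\<in>{1..k}. m' l = max (m l) (\<alpha> l v))}\<rparr>"

primrec GoodEp0_iter ::
  "'v game \<Rightarrow> nat \<Rightarrow> (nat \<Rightarrow> nat) \<Rightarrow> (nat \<Rightarrow> 'v \<Rightarrow> nat) \<Rightarrow> nat \<Rightarrow> 'v set" where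
  "GoodEp0_iter G k d \<alpha> 0 = verts G"
| "GoodEp0_iter G k d \<alpha> (Suc j) =
     (let F = GoodEp0_iter G k d \<alpha> j;
          T = {(v, m). v \<in> F \<and> m \<in> memories k d \<and> (\<forall>l\<in>{1..k}. even (m l))};
          A = PAttr0 (extended_game G k d \<alpha>) T
      in {v \<in> verts G. (v, \<lambda>l\<in>{1..k}. \<alpha> l v) \<in> A} \<inter> F)"

definition GoodEp0 ::
  "'v game \<Rightarrow> nat \<Rightarrow> (nat \<Rightarrow> nat) \<Rightarrow> (nat \<Rightarrow> 'v \<Rightarrow> nat) \<Rightarrow> 'v set" where
  "GoodEp0 G k d \<alpha> = (\<Inter>j. GoodEp0_iter G k d \<alpha> j)"

lemma game_structure_extended_game:
  assumes G: "game_structure G"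
    and \<alpha>: "\<forall>l\<in>{1..k}. \<alpha> l \<in> verts G \<rightarrow> {0..d l}"
  shows "game_structure (extended_game G k d \<alpha>)"
proof -
  let ?H = "extended_game G k d \<alpha>"
  have verts: "verts ?H = verts G \<times> memories k d"
    by (auto simp: verts_def extended_game_def)
  have "finite (memories k d)"
    by (auto simp: memories_def intro!: finite_PiE)
  then have "finite (verts ?H)"
    using G by (simp add: verts game_structure_def)
  moreover have "ctrl ?H Player0 \<inter> ctrl ?H Player1 = {}"
    using G by (auto simp: extended_game_def game_structure_def)
  moreover have "edges ?H \<subseteq> verts ?H \<times> verts ?H"
    using G unfolding verts by (auto simp: extended_game_def game_structure_def)
  moreover have "\<exists>x'. (x, x') \<in> edges ?H" if x: "x \<in> verts ?H" for x
  proof -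
    obtain v m where vm: "x = (v, m)" "v \<in> verts G" "m \<in> memories k d"
      using x by (auto simp: verts)
    obtain v' where v': "(v, v') \<in> edges G"
      using G vm by (auto simp: game_structure_def)
    let ?m = "\<lambda>l\<in>{1..k}. max (m l) (\<alpha> l v)"
    have "?m \<in> memories k d"
      using vm \<alpha> by (fastforce simp: memories_def PiE_iff Pi_iff)
    then have "(x, (v', ?m)) \<in> edges ?H"
      using vm v' by (simp add: extended_game_def)
    then show ?thesis ..
  qed
  ultimately show ?thesis
    by (simp add: game_structure_def)
qed

end

(*
  A good episode starts in a vertex v of F = GoodEp0 and, whatever the opponent does, ends after at
  least one step in a vertex of F such that every priority maximum over the episode (last vertex
  excluded) is even.  After the attractor phase, Player 0 concatenates good episodes forever,
  remembering the maxima of the current one.  If a vertex w realises the l-th maximum over Inf, then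
  w occurs in an episode that visits only vertices of Inf; the even maximum of this episode is the
  priority of w.
*)
theory Submission
  imports Defs
begin

section \<open>Attractor ranks and projection of the extended game\<close>

lemma Cpre0_mono: "U \<subseteq> W \<Longrightarrow> Cpre0 G U \<subseteq> Cpre0 G W"
  by (auto simp: Cpre0_def)

text \<open>The rank is the first stage of the iteration that contains the vertex: a vertex new at
  stage \<open>Suc j\<close> can only come from \<open>Cpre0\<close> of stage \<open>j\<close> and
  \<open>U\<close>. This turns a positive attractor into a progress measure: each step hits
  \<open>U\<close> or lowers the rank.\<close>

lemma PAttr0_rank:
  "\<exists>r :: 'v \<Rightarrow> nat. \<forall>v\<in>PAttr0 G U. v \<in> Cpre0 G (U \<union> {w \<in> PAttr0 G U. r w < r v})"
proof (intro exI ballI)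
  let ?r = "\<lambda>v. LEAST j. v \<in> PAttr0_iter G U j"
  fix v assume "v \<in> PAttr0 G U"
  then have v: "v \<in> PAttr0_iter G U (?r v)"
    unfolding PAttr0_def by (metis LeastI UN_iff)
  show "v \<in> Cpre0 G (U \<union> {w \<in> PAttr0 G U. ?r w < ?r v})"
  proof (cases "?r v")
    case 0
    then have "v \<in> Cpre0 G U" using v by simp
    then show ?thesis using Cpre0_mono[of U "U \<union> _"] by blast
  next
    case (Suc j)
    then have "v \<notin> PAttr0_iter G U j"
      using not_less_Least[of j "\<lambda>j. v \<in> PAttr0_iter G U j"] by simp
    then have "v \<in> Cpre0 G (PAttr0_iter G U j \<union> U)" using v Suc by simp
    moreover have "PAttr0_iter G U j \<subseteq> {w \<in> PAttr0 G U. ?r w < ?r v}"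
      using Suc by (auto simp: PAttr0_def less_Suc_eq_le intro: Least_le)
    ultimately show ?thesis
      using Cpre0_mono[of "PAttr0_iter G U j \<union> U" "U \<union> {w \<in> PAttr0 G U. ?r w < ?r v}"] by blast
  qed
qed

text \<open>Lets the initial attraction phase use the same kind of ranks as the episodes.\<close>

lemma Attr0_subset_PAttr0: "Attr0 G U \<subseteq> U \<union> PAttr0 G U"
proof -
  have "Attr0_iter G U j \<subseteq> U \<union> PAttr0_iter G U j" for j
  proof (induction j)
    case (Suc j)
    then show ?case
      using Cpre0_mono[of "Attr0_iter G U j" "PAttr0_iter G U j \<union> U" G] by auto
  qed simp
  then show ?thesis by (fastforce simp: Attr0_def PAttr0_def)
qed

text \<open>The memory evolves deterministically and does not affect whose turn it is, so the moves
  from \<open>(v, m)\<close> correspond to those from \<open>v\<close>.\<close>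

lemma Cpre0_extended_game:
  assumes \<alpha>: "\<forall>l\<in>{1..k}. \<alpha> l \<in> verts G \<rightarrow> {0..d l}"
    and vm: "(v, m) \<in> Cpre0 (extended_game G k d \<alpha>) W"
  shows "v \<in> Cpre0 G {v'. (v', \<lambda>l\<in>{1..k}. max (m l) (\<alpha> l v)) \<in> W}"
proof -
  let ?m = "\<lambda>l\<in>{1..k}. max (m l) (\<alpha> l v)"
  have m: "m \<in> memories k d" and v: "v \<in> verts G"
    using vm by (auto simp: Cpre0_def extended_game_def verts_def)
  then have m': "?m \<in> memories k d"
    using \<alpha> by (fastforce simp: memories_def PiE_iff Pi_iff)
  \<comment> \<open>Tuples are \<open>undefined\<close> outside \<open>{1..k}\<close>, so the update
    equations determine the new memory uniquely.\<close>
  have m_eq: "m' \<in> memories k d \<and> (\<forall>l\<in>{1..k}. m' l = max (m l) (\<alpha> l v)) \<longleftrightarrow> m' = ?m" for m'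
    using m' PiE_ext[of m' "{1..k}" "\<lambda>l. {0..d l}" ?m] unfolding memories_def by auto
  have "((v, m), x) \<in> edges (extended_game G k d \<alpha>) \<longleftrightarrow> (v, fst x) \<in> edges G \<and> snd x = ?m" for x
    using m m_eq[of "snd x"] by (auto simp add: extended_game_def case_prod_beta simp del: atLeastAtMost_iff)
  moreover have "ctrl (extended_game G k d \<alpha>) i = ctrl G i \<times> memories k d" for i
    by (simp add: extended_game_def)
  ultimately show ?thesis
    using vm by (auto simp: Cpre0_def)
qed

section \<open>Stabilisation of the iteration defining \<open>GoodEp0\<close>\<close>

lemma GoodEp0_iter_antimono: "i \<le> j \<Longrightarrow> GoodEp0_iter G k d \<alpha> j \<subseteq> GoodEp0_iter G k d \<alpha> i"
  by (rule lift_Suc_antimono_le[of "GoodEp0_iter G k d \<alpha>"]) (simp_all add: Let_def)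

lemma GoodEp0_eq_iter:
  assumes "finite (verts G)"
  obtains J where "GoodEp0 G k d \<alpha> = GoodEp0_iter G k d \<alpha> J"
proof -
  let ?F = "GoodEp0_iter G k d \<alpha>"
  have fin: "finite (?F j)" for j
    using GoodEp0_iter_antimono[of 0 j G k d \<alpha>] assms finite_subset by auto
  \<comment> \<open>At a stage of least cardinality the sequence is stable: a later stage is a
    subset that is not smaller.\<close>
  obtain J where J: "\<And>j. card (?F J) \<le> card (?F j)"
    using ex_has_least_nat[of "\<lambda>_. True" 0 "\<lambda>j. card (?F j)"] by auto
  have "?F J \<subseteq> ?F j" for j
  proof (cases "j \<le> J")
    case True
    then show ?thesis by (rule GoodEp0_iter_antimono)
  next
    case False
    then have "?F j \<subseteq> ?F J" using GoodEp0_iter_antimono[of J j G k d \<alpha>] by simp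
    then have "?F j = ?F J" using card_seteq[OF fin _ J] by simp
    then show ?thesis by simp
  qed
  then have "GoodEp0 G k d \<alpha> = ?F J" by (auto simp: GoodEp0_def)
  then show thesis by (rule that)
qed

text \<open>Since the intersection equals some stage \<open>J\<close>, membership in stage
  \<open>Suc J\<close> yields episodes that end in \<open>GoodEp0\<close> itself, so they can be
  chained.\<close>

lemma GoodEp0_PAttr0:
  assumes "finite (verts G)" and "v \<in> GoodEp0 G k d \<alpha>"
  shows "(v, \<lambda>l\<in>{1..k}. \<alpha> l v) \<in> PAttr0 (extended_game G k d \<alpha>)
    {(v, m). v \<in> GoodEp0 G k d \<alpha> \<and> m \<in> memories k d \<and> (\<forall>l\<in>{1..k}. even (m l))}"
proof -
  obtain J where J: "GoodEp0 G k d \<alpha> = GoodEp0_iter G k d \<alpha> J"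
    using GoodEp0_eq_iter[OF assms(1)] by blast
  have "v \<in> GoodEp0_iter G k d \<alpha> (Suc J)"
    using assms(2) by (auto simp: GoodEp0_def simp del: GoodEp0_iter.simps)
  then show ?thesis by (simp add: J Let_def)
qed

section \<open>Strategies with memory\<close>

text \<open>\<open>I\<close> is an invariant that Player 0 can maintain while forcing
  \<open>ok\<close> on every step. The state set may be arbitrary, since the state is recomputed
  from the history.\<close>

lemma memory_strategy:
  fixes upd :: "'s \<Rightarrow> 'v \<Rightarrow> 'v \<Rightarrow> 's" and ok :: "'s \<Rightarrow> 'v \<Rightarrow> 'v \<Rightarrow> bool"
  assumes G: "game_structure G"
    and init: "I s0 v0"
    and step: "\<And>s v. I s v \<Longrightarrow> v \<in> Cpre0 G {v'. ok s v v' \<and> I (upd s v v') v'}"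
  obtains \<sigma> where "strategy G Player0 \<sigma>"
    and "\<And>\<pi>. play G \<pi> \<Longrightarrow> \<pi> 0 = v0 \<Longrightarrow> consistent G Player0 \<sigma> \<pi> \<Longrightarrow>
      \<exists>\<mu>. \<forall>n. \<mu> (Suc n) = upd (\<mu> n) (\<pi> n) (\<pi> (Suc n)) \<and> ok (\<mu> n) (\<pi> n) (\<pi> (Suc n))"
proof -
  let ?good = "\<lambda>s v v'. (v, v') \<in> edges G \<and> ok s v v' \<and> I (upd s v v') v'"
  \<comment> \<open>Outside the invariant any edge serves as default, because a strategy must be
    legal on all histories.\<close>
  define pick where "pick s v = (SOME v'. (v, v') \<in> edges G \<and> (I s v \<longrightarrow> ?good s v v'))" for s v
  have pick: "(v, pick s v) \<in> edges G \<and> (I s v \<longrightarrow> ?good s v (pick s v))"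
    if v: "v \<in> ctrl G Player0" for s v
  proof -
    have "\<exists>v'. (v, v') \<in> edges G \<and> (I s v \<longrightarrow> ?good s v v')"
    proof (cases "I s v")
      case True
      then show ?thesis using step[OF True] v G by (auto simp: Cpre0_def game_structure_def)
    next
      case False
      then show ?thesis using v G by (auto simp: game_structure_def verts_def)
    qed
    then show ?thesis unfolding pick_def by (rule someI_ex)
  qed
  \<comment> \<open>The current vertex is carried along because \<open>upd\<close> needs both ends
    of each edge.\<close>
  define st where "st h = foldl (\<lambda>(s, v) v'. (upd s v v', v')) (s0, hd h) (tl h)" for h
  define \<sigma> where "\<sigma> h = pick (fst (st h)) (last h)" for h
  show thesis
  proof
    show "strategy G Player0 \<sigma>"
      using pick by (auto simp: strategy_def \<sigma>_def)
  next
    fix \<pi> assume play: "play G \<pi>" and \<pi>0: "\<pi> 0 = v0" and con: "consistent G Player0 \<sigma> \<pi>"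
    define \<mu> where "\<mu> n = fst (st (map \<pi> [0..<Suc n]))" for n
    have tl_upt: "tl (map \<pi> [0..<Suc n]) = map \<pi> [Suc 0..<Suc n]" for n
      by (simp add: map_tl upt_conv_Cons del: upt_Suc)
    have hd_upt: "hd (map \<pi> [0..<Suc n]) = \<pi> 0" for n
      by (simp add: upt_conv_Cons del: upt_Suc)
    have st: "st (map \<pi> [0..<Suc n]) =
        foldl (\<lambda>(s, v) v'. (upd s v v', v')) (s0, v0) (map \<pi> [Suc 0..<Suc n])" for n
      unfolding st_def tl_upt hd_upt \<pi>0 ..
    have snd: "snd (st (map \<pi> [0..<Suc n])) = \<pi> n" for n
      unfolding st using \<pi>0 by (cases n) (auto split: prod.split)
    have \<mu>_Suc: "\<mu> (Suc n) = upd (\<mu> n) (\<pi> n) (\<pi> (Suc n))" for n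
    proof -
      have "st (map \<pi> [0..<Suc (Suc n)]) =
          (case st (map \<pi> [0..<Suc n]) of (s, v) \<Rightarrow> (upd s v (\<pi> (Suc n)), \<pi> (Suc n)))"
        unfolding st by (simp add: case_prod_beta)
      then show ?thesis
        unfolding \<mu>_def using snd[of n] by (simp add: case_prod_beta del: upt_Suc)
    qed
    have good: "?good (\<mu> n) (\<pi> n) (\<pi> (Suc n))" if I: "I (\<mu> n) (\<pi> n)" for n
    proof (cases "\<pi> n \<in> ctrl G Player0")
      case True
      then have "\<pi> (Suc n) = pick (\<mu> n) (\<pi> n)"
        using con by (simp add: consistent_def \<sigma>_def \<mu>_def)
      then show ?thesis using pick[OF True] I by simp
    next
      case False
      then show ?thesis using step[OF I] play by (auto simp: Cpre0_def play_def)
    qed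
    have "I (\<mu> n) (\<pi> n)" for n
    proof (induction n)
      case 0
      then show ?case using init by (simp add: \<mu>_def st_def \<pi>0)
    next
      case (Suc n)
      then show ?case using good \<mu>_Suc by simp
    qed
    then show "\<exists>\<mu>. \<forall>n. \<mu> (Suc n) = upd (\<mu> n) (\<pi> n) (\<pi> (Suc n)) \<and> ok (\<mu> n) (\<pi> n) (\<pi> (Suc n))"
      using \<mu>_Suc good by blast
  qed
qed

section \<open>Recurrence and limit maxima of sequences\<close>

lemma frequently_if_rank_decreases:
  fixes r :: "nat \<Rightarrow> nat"
  assumes "\<And>n. P n \<or> r (Suc n) < r n"
  shows "\<exists>\<^sub>\<infinity>n. P n"
proof (rule ccontr)
  assume "\<not> (\<exists>\<^sub>\<infinity>n. P n)"
  then obtain N where "\<And>n. n \<ge> N \<Longrightarrow> \<not> P n"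
    by (auto simp: INFM_nat_le)
  then have "r (Suc (N + i)) < r (N + i)" for i
    using assms[of "N + i"] by simp
  then have "r (N + i) + i \<le> r N" for i
    by (induction i) (simp, metis Suc_leI add_Suc_right add_le_mono1 add_Suc le_trans)
  from this[of "Suc (r N)"] show False by simp
qed

text \<open>\<open>R n\<close> says that an episode ends at position \<open>n\<close> and the next
  one begins at \<open>Suc n\<close>; hence the half-open intervals \<open>{n<..p}\<close>.\<close>

lemma even_Max_inf_vertices:
  assumes fin: "finite (range \<pi>)"
    and R: "\<exists>\<^sub>\<infinity>n. R n"
    and episode: "\<And>n p. R n \<Longrightarrow> R p \<Longrightarrow> n < p \<Longrightarrow> (\<And>q. n < q \<Longrightarrow> q < p \<Longrightarrow> \<not> R q) \<Longrightarrow>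
      even (Max ((\<lambda>i. a (\<pi> i)) ` {n<..p}))"
  shows "even (Max (a ` inf_vertices \<pi>) :: nat)"
proof -
  \<comment> \<open>Each of the finitely many other values eventually disappears, so a common bound
    \<open>N\<close> exists.\<close>
  have "\<forall>v\<in>range \<pi> - inf_vertices \<pi>. \<forall>\<^sub>\<infinity>n. \<pi> n \<noteq> v"
    by (simp add: inf_vertices_def)
  then have "\<forall>\<^sub>\<infinity>n. \<forall>v\<in>range \<pi> - inf_vertices \<pi>. \<pi> n \<noteq> v"
    using fin by (intro eventually_ball_finite) simp_all
  then obtain N where N: "\<And>n. n \<ge> N \<Longrightarrow> \<pi> n \<in> inf_vertices \<pi>"
    unfolding MOST_nat_le by blast
  have "inf_vertices \<pi> \<subseteq> range \<pi>"
    by (auto simp: inf_vertices_def dest: INFM_EX)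
  then have fin': "finite (inf_vertices \<pi>)"
    using fin finite_subset by blast
  then obtain w where w: "w \<in> inf_vertices \<pi>" "a w = Max (a ` inf_vertices \<pi>)"
    using N[of N] Max_in[of "a ` inf_vertices \<pi>"] by fastforce
  \<comment> \<open>The boundary \<open>b\<close> keeps the episode around the later position
    \<open>i\<close> entirely beyond \<open>N\<close>.\<close>
  obtain b where b: "b \<ge> N" "R b"
    using R by (auto simp: INFM_nat_le)
  obtain i where i: "i > b" "\<pi> i = w"
    using w(1) by (auto simp: inf_vertices_def INFM_nat)
  \<comment> \<open>The episode containing \<open>i\<close> lies between the last boundary strictly
    before \<open>i\<close> and the first boundary \<open>p\<close> at or after \<open>i\<close>;
    \<open>p = i\<close> is possible.\<close>
  define n where "n = (GREATEST n. R n \<and> n < i)"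
  have n: "R n \<and> n < i"
    unfolding n_def by (rule GreatestI_nat[of _ b i]) (use b i in auto)
  have n_max: "q \<le> n" if "R q" "q < i" for q
    unfolding n_def by (rule Greatest_le_nat[of _ _ i]) (use that in auto)
  define p where "p = (LEAST p. R p \<and> i \<le> p)"
  have p: "R p \<and> i \<le> p"
    unfolding p_def by (rule LeastI_ex) (use R in \<open>auto simp: INFM_nat_le\<close>)
  have p_min: "p \<le> q" if "R q" "i \<le> q" for q
    unfolding p_def by (rule Least_le) (use that in auto)
  have "even (Max ((\<lambda>i. a (\<pi> i)) ` {n<..p}))"
  proof (rule episode)
    fix q assume "n < q" "q < p"
    then show "\<not> R q" using n_max[of q] p_min[of q] by force
  qed (use n p in auto)
  moreover have "Max ((\<lambda>i. a (\<pi> i)) ` {n<..p}) = a w"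
  proof (rule Max_eqI)
    fix x assume "x \<in> (\<lambda>i. a (\<pi> i)) ` {n<..p}"
    then obtain j where j: "x = a (\<pi> j)" "n < j" by auto
    have "\<pi> j \<in> inf_vertices \<pi>"
      using n_max[of b] b i j by (intro N) auto
    then show "x \<le> a w" using w(2) j fin' by simp
  qed (use i n p in auto)
  ultimately show ?thesis using w(2) by simp
qed

section \<open>Chaining good episodes into a winning strategy\<close>

theorem proposition8:
  fixes G :: "'v game"
    and k :: nat
    and d :: "nat \<Rightarrow> nat"
    and \<alpha> :: "nat \<Rightarrow> 'v \<Rightarrow> nat"
  assumes "game_structure G"
    and "k \<ge> 1"
    and "\<forall>l\<in>{1..k}. \<alpha> l \<in> verts G \<rightarrow> {0..d l}"
  shows "\<forall>v0\<in>verts G. v0 \<in> Attr0 G (GoodEp0 G k d \<alpha>) \<longrightarrow>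
           v0 \<in> Win G Player0 (ConjEvenParity G k \<alpha>)"
proof (intro ballI impI)
  fix v0 assume v0: "v0 \<in> verts G" "v0 \<in> Attr0 G (GoodEp0 G k d \<alpha>)"
  let ?X = "extended_game G k d \<alpha>"
  define F where "F = GoodEp0 G k d \<alpha>"
  define T where "T = {(v, m). v \<in> F \<and> m \<in> memories k d \<and> (\<forall>l\<in>{1..k}. even (m l))}"
  define start where "start v = (\<lambda>l\<in>{1..k}. \<alpha> l v)" for v
  define next_mem where "next_mem m v = (\<lambda>l\<in>{1..k}. max (m l) (\<alpha> l v))" for m v
  have fin: "finite (verts G)"
    using assms(1) by (simp add: game_structure_def)
  have F_PAttr: "(v, start v) \<in> PAttr0 ?X T" if "v \<in> F" for v
    using GoodEp0_PAttr0[OF fin] that by (simp add: F_def T_def start_def)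
  obtain r :: "'v \<Rightarrow> nat"
    where r: "\<forall>v\<in>PAttr0 G F. v \<in> Cpre0 G (F \<union> {w \<in> PAttr0 G F. r w < r v})"
    using PAttr0_rank[of G F] by blast
  obtain rX :: "'v \<times> (nat \<Rightarrow> nat) \<Rightarrow> nat"
    where rX: "\<forall>x\<in>PAttr0 ?X T. x \<in> Cpre0 ?X (T \<union> {y \<in> PAttr0 ?X T. rX y < rX x})"
    using PAttr0_rank[of ?X T] by blast
  \<comment> \<open>Memory \<open>None\<close>: still attracting to \<open>F\<close>; \<open>Some m\<close>: inside an episode with maxima \<open>m\<close>,
    not counting the current vertex unless it is the first one.\<close>
  define reset where "reset s v v' \<longleftrightarrow> v' \<in> F \<and>
      (case s of None \<Rightarrow> True | Some m \<Rightarrow> \<forall>l\<in>{1..k}. even (max (m l) (\<alpha> l v)))" for s v v'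
  \<comment> \<open>When \<open>(v', next_mem m v)\<close> reaches \<open>T\<close>, the old maxima
    are discarded and \<open>v'\<close> opens a new episode. Its memory \<open>start v'\<close>
    already counts \<open>v'\<close>; counting \<open>v'\<close> again on leaving it does not change
    the maxima.\<close>
  define upd where "upd s v v' =
      (if reset s v v' then Some (start v') else map_option (\<lambda>m. next_mem m v) s)" for s v v'
  define rank where "rank s v = (case s of None \<Rightarrow> r v | Some m \<Rightarrow> rX (v, m))" for s v
  define I where "I s v \<longleftrightarrow>
      (case s of None \<Rightarrow> v \<in> PAttr0 G F | Some m \<Rightarrow> (v, m) \<in> PAttr0 ?X T)" for s v
  \<comment> \<open>The rank may jump up at a reset but drops at every other step, so resets recur
    forever.\<close>
  define ok where "ok s v v' \<longleftrightarrow> reset s v v' \<or> rank (upd s v v') v' < rank s v" for s v v'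
  have step: "v \<in> Cpre0 G {v'. ok s v v' \<and> I (upd s v v') v'}" if I: "I s v" for s v
  proof (cases s)
    case None
    then have "v \<in> Cpre0 G (F \<union> {w \<in> PAttr0 G F. r w < r v})"
      using I r by (simp add: I_def)
    moreover have "F \<union> {w \<in> PAttr0 G F. r w < r v} \<subseteq> {v'. ok s v v' \<and> I (upd s v v') v'}"
      using None F_PAttr by (auto simp: ok_def I_def upd_def reset_def rank_def)
    ultimately show ?thesis using Cpre0_mono by blast
  next
    case (Some m)
    let ?W = "T \<union> {y \<in> PAttr0 ?X T. rX y < rX (v, m)}"
    have "v \<in> Cpre0 G {v'. (v', next_mem m v) \<in> ?W}"
      using Cpre0_extended_game[OF assms(3) rX[rule_format]] I Some by (simp add: I_def next_mem_def)
    moreover have "{v'. (v', next_mem m v) \<in> ?W} \<subseteq> {v'. ok s v v' \<and> I (upd s v v') v'}"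
    proof
      fix v' assume v': "v' \<in> {v'. (v', next_mem m v) \<in> ?W}"
      show "v' \<in> {v'. ok s v v' \<and> I (upd s v v') v'}"
      proof (cases "reset s v v'")
        case True
        then show ?thesis using F_PAttr by (simp add: ok_def I_def upd_def reset_def)
      next
        case False
        then have "(v', next_mem m v) \<notin> T"
          using Some by (auto simp: T_def reset_def next_mem_def)
        then show ?thesis using v' False Some by (simp add: ok_def I_def upd_def rank_def)
      qed
    qed
    ultimately show ?thesis using Cpre0_mono by blast
  qed
  \<comment> \<open>A vertex of \<open>F\<close> need not lie in \<open>PAttr0 G F\<close>, but it
    can open an episode at once.\<close>
  define s0 where "s0 = (if v0 \<in> F then Some (start v0) else None)"
  have "I s0 v0"
    using v0(2) F_PAttr Attr0_subset_PAttr0[of G F] by (auto simp: I_def s0_def F_def)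
  then obtain \<sigma> where \<sigma>: "strategy G Player0 \<sigma>"
    and win: "\<And>\<pi>. play G \<pi> \<Longrightarrow> \<pi> 0 = v0 \<Longrightarrow> consistent G Player0 \<sigma> \<pi> \<Longrightarrow>
      \<exists>\<mu>. \<forall>n. \<mu> (Suc n) = upd (\<mu> n) (\<pi> n) (\<pi> (Suc n)) \<and> ok (\<mu> n) (\<pi> n) (\<pi> (Suc n))"
    using memory_strategy[OF assms(1), of I s0 v0 ok upd] step by blast
  have "\<pi> \<in> ConjEvenParity G k \<alpha>"
    if play: "play G \<pi>" and \<pi>: "\<pi> 0 = v0" "consistent G Player0 \<sigma> \<pi>" for \<pi>
  proof -
    obtain \<mu> where \<mu>: "\<And>n. \<mu> (Suc n) = upd (\<mu> n) (\<pi> n) (\<pi> (Suc n))"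
      and ok: "\<And>n. ok (\<mu> n) (\<pi> n) (\<pi> (Suc n))"
      using win[OF play \<pi>] by blast
    define R where "R n \<longleftrightarrow> reset (\<mu> n) (\<pi> n) (\<pi> (Suc n))" for n
    have "\<exists>\<^sub>\<infinity>n. R n"
      by (rule frequently_if_rank_decreases[of R "\<lambda>n. rank (\<mu> n) (\<pi> n)"])
        (use ok \<mu> in \<open>simp add: ok_def R_def\<close>)
    moreover have "range \<pi> \<subseteq> verts G"
      using play assms(1) by (auto simp: play_def game_structure_def)
    then have "finite (range \<pi>)"
      using fin finite_subset by blast
    moreover have "even (Max ((\<lambda>i. \<alpha> l (\<pi> i)) ` {n<..p}))"
      if l: "l \<in> {1..k}" and n: "R n" and p: "R p" "n < p"
        and between: "\<And>q. n < q \<Longrightarrow> q < p \<Longrightarrow> \<not> R q" for l n p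
    proof -
      \<comment> \<open>The memory lags one vertex behind; with the current priority added, as in
        the test of \<open>reset\<close>, it gives the maximum over the episode so far. At
        \<open>q = p\<close> that test yields evenness.\<close>
      have "q \<le> p \<Longrightarrow> \<exists>m. \<mu> q = Some m \<and>
          max (m l) (\<alpha> l (\<pi> q)) = Max ((\<lambda>i. \<alpha> l (\<pi> i)) ` {n<..q})"
        if "Suc n \<le> q" for q
        using that
      proof (induction q rule: dec_induct)
        case base
        have "{n<..Suc n} = {Suc n}" by auto
        then show ?case using n l \<mu>[of n] by (simp add: R_def upd_def start_def)
      next
        case (step q)
        then obtain m where m: "\<mu> q = Some m"
          "max (m l) (\<alpha> l (\<pi> q)) = Max ((\<lambda>i. \<alpha> l (\<pi> i)) ` {n<..q})"
          by auto
        have "\<not> R q" using between step by simp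
        then have "\<mu> (Suc q) = Some (next_mem m (\<pi> q))"
          using \<mu>[of q] m(1) by (simp add: R_def upd_def)
        moreover have "{n<..Suc q} = insert (Suc q) {n<..q}" "{n<..q} \<noteq> {}"
          using step by auto
        ultimately show ?case
          using m(2) l by (simp add: next_mem_def max.commute)
      qed
      from this[of p] obtain m where m: "\<mu> p = Some m"
          "max (m l) (\<alpha> l (\<pi> p)) = Max ((\<lambda>i. \<alpha> l (\<pi> i)) ` {n<..p})"
        using p by auto
      have "even (max (m l) (\<alpha> l (\<pi> p)))"
        using p(1) l m(1) by (auto simp: R_def reset_def)
      then show ?thesis using m(2) by simp
    qed
    ultimately have "even (Max (\<alpha> l ` inf_vertices \<pi>))" if "l \<in> {1..k}" for l
      using even_Max_inf_vertices[of \<pi> R "\<alpha> l"] that by blast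
    then show ?thesis using play by (simp add: ConjEvenParity_def)
  qed
  then show "v0 \<in> Win G Player0 (ConjEvenParity G k \<alpha>)"
    using v0(1) \<sigma> by (auto simp: Win_def)
qed

end
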